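(* Let $Y$ be a real random variable whose moment generating function exists in a neighborhood of the origin and such that $E[Y]\ne0$. Let $q(x)$ be any polynomial of degree $n$ with complex coefficients, and let $$q(x)=\sum_{r=0}^{n}a_{r}\mathcal{E}_{r}^{Y}(x).$$ Then, for $0\le r\le n$, the coefficients are determined by \begin{align*} a_{r}&=\frac{1}{2}\sum_{j=r}^{n}S_{1}^{Y}(j,r)\frac{1}{j!}\big(\Delta^{j}q(1)+\Delta^{j}q(0) \big) \\ &=\frac{1}{2}\sum_{j=r}^{n}\sum_{i=0}^{j}(-1)^{j-i}\frac{1}{j!}\binom{j}{i}S_{1}^{Y}(j,r)\big(q(i+1)+q(i)\big) \\ &=\frac{1}{2}\sum_{j=r}^{n}\sum_{l=j}^{n}S_{1}^{Y}(j,r)S_{2}(l,j)\frac{1}{l!}\big(q^{(l)}(1)+q^{(l)}(0) \big). \end{align*}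
   Context: Existence of the moment generating function near the origin means that for some $r_0>0$, $E[e^{Yt}]=\sum_{n\ge 0}E[Y^n]\frac{t^n}{n!}$ exists for $|t|<r_0$. The probabilistic Euler polynomials $\mathcal{E}_n^Y(x)$ associated with $Y$ are defined by $$\frac{2}{E[e^{Yt}]+1}\big(E[e^{Yt}]\big)^{x}=\sum_{n=0}^{\infty}\mathcal{E}_{n}^{Y}(x)\frac{t^{n}}{n!},$$ where $(E[e^{Yt}])^x=\sum_{k\ge0}(x)_k\frac{1}{k!}(E[e^{Yt}]-1)^k$ and $(x)_0=1$, $(x)_k=x(x-1)\cdots(x-k+1)$. Put $e_Y(t)=E[e^{Yt}]-1$, a power series with zero constant term and linear coefficient $E[Y]\ne0$, and let $\bar e_Y(t)$ be its compositional inverse; the probabilistic Stirling numbers of the first kind associated with $Y$ are defined, for $k\ge0$, by $\frac{1}{k!}(\bar e_Y(t))^k=\sum_{n\ge k}S_1^Y(n,k)\frac{t^n}{n!}$. $S_2(n,k)$ are the Stirling numbers of the second kind, $\frac{1}{k!}(e^t-1)^k=\sum_{n\ge k}S_2(n,k)\frac{t^n}{n!}$. $\Delta$ is the forward difference operator, $\Delta a(x)=a(x+1)-a(x)$; $\Delta^jq(c)$ denotes $\Delta^j q(x)$ evaluated at $x=c$, and $q^{(l)}$ is the $l$-th derivative. *)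

theory Defs
  imports
    "HOL-Probability.Probability"
    "HOL-Computational_Algebra.Formal_Power_Series"
    "HOL-Combinatorics.Stirling"
begin

definition mgf_exists_near_0 :: "'a measure \<Rightarrow> ('a \<Rightarrow> real) \<Rightarrow> bool" where
  "mgf_exists_near_0 M Y \<longleftrightarrow>
     (\<exists>r0>0. \<forall>t::real. \<bar>t\<bar> < r0 \<longrightarrow> integrable M (\<lambda>\<omega>. exp (Y \<omega> * t)))"

text \<open>
  The series of \<open>E[e^(Y t)]\<close> in \<open>t\<close>. Its coefficients are real; they are embedded in the
  complex numbers because the argument \<open>x\<close> of the Euler polynomials is complex.
  That it converges to the moment generating function is \<open>mgf_series_sums\<close> below.
\<close>
definition mgf_series :: "'a measure \<Rightarrow> ('a \<Rightarrow> real) \<Rightarrow> complex fps" where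
  "mgf_series M Y = Abs_fps (\<lambda>n. of_real (integral\<^sup>L M (\<lambda>\<omega>. Y \<omega> ^ n)) / fact n)"

text \<open>
  \<open>(E[e^(Y t)])^x\<close> is the sum over \<open>k\<close> of \<open>(x)\<^sub>k / k! * (E[e^(Y t)] - 1)^k\<close>, that is, the
  composition of \<open>fps_binomial x\<close> (whose coefficients are \<open>x gchoose k = (x)\<^sub>k / k!\<close>) with a
  series without constant term.
\<close>
definition prob_euler :: "'a measure \<Rightarrow> ('a \<Rightarrow> real) \<Rightarrow> nat \<Rightarrow> complex \<Rightarrow> complex" where
  "prob_euler M Y n x =
     fact n * fps_nth (2 / (mgf_series M Y + 1) * (fps_binomial x oo (mgf_series M Y - 1))) n"

definition prob_stirling1 :: "'a measure \<Rightarrow> ('a \<Rightarrow> real) \<Rightarrow> nat \<Rightarrow> nat \<Rightarrow> complex" where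
  "prob_stirling1 M Y n k =
     fact n * fps_nth (fps_const (1 / fact k) * fps_inv (mgf_series M Y - 1) ^ k) n"

definition fwd_diff :: "(complex \<Rightarrow> complex) \<Rightarrow> complex \<Rightarrow> complex" where
  "fwd_diff f x = f (x + 1) - f x"

lemma mgf_series_sums:
  fixes t :: real
  assumes M: "prob_space M" and Y: "Y \<in> borel_measurable M"
    and r0: "\<And>t. \<bar>t\<bar> < r0 \<Longrightarrow> integrable M (\<lambda>\<omega>. exp (Y \<omega> * t))" and t: "\<bar>t\<bar> < r0"
  shows "integrable M (\<lambda>\<omega>. Y \<omega> ^ n)"
    and "(\<lambda>n. fps_nth (mgf_series M Y) n * of_real t ^ n) sums
           of_real (integral\<^sup>L M (\<lambda>\<omega>. exp (Y \<omega> * t)))"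
proof -
  interpret prob_space M by fact
  note [measurable] = Y
  have dom: "integrable M (\<lambda>\<omega>. exp \<bar>Y \<omega> * s\<bar>)" if "\<bar>s\<bar> < r0" for s
  proof (rule Bochner_Integration.integrable_bound)
    show "integrable M (\<lambda>\<omega>. exp (Y \<omega> * s) + exp (Y \<omega> * (- s)))"
      using that by (intro Bochner_Integration.integrable_add r0) auto
    show "AE \<omega> in M. norm (exp \<bar>Y \<omega> * s\<bar>) \<le> norm (exp (Y \<omega> * s) + exp (Y \<omega> * (- s)))"
    proof (intro AE_I2)
      fix \<omega>
      have "exp \<bar>Y \<omega> * s\<bar> \<le> exp (Y \<omega> * s) + exp (Y \<omega> * (- s))"
        by (auto simp: abs_if)
      then show "norm (exp \<bar>Y \<omega> * s\<bar>) \<le> norm (exp (Y \<omega> * s) + exp (Y \<omega> * (- s)))"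
        by (simp only: real_norm_def abs_exp_cancel)
    qed
  qed measurable
  have term_le: "\<bar>z\<bar> ^ k / fact k \<le> exp \<bar>z\<bar>" for z :: real and k
  proof -
    have "(\<Sum>n\<in>{k}. \<bar>z\<bar> ^ n /\<^sub>R fact n) \<le> exp \<bar>z\<bar>"
      unfolding exp_def by (intro sum_le_suminf summable_exp_generic) auto
    then show ?thesis by (simp add: divide_inverse mult.commute)
  qed
  have int: "integrable M (\<lambda>\<omega>. (Y \<omega> * s) ^ k / fact k)" if "\<bar>s\<bar> < r0" for s k
    by (rule Bochner_Integration.integrable_bound[OF dom[OF that]])
       (use term_le in \<open>auto simp: power_abs simp flip: abs_mult\<close>)
  have int_pow: "integrable M (\<lambda>\<omega>. Y \<omega> ^ k)" for k
  proof -
    have "r0 > 0" using t by linarith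
    then have "integrable M (\<lambda>\<omega>. (fact k / (r0/2) ^ k) * ((Y \<omega> * (r0/2)) ^ k / fact k))"
      by (intro integrable_mult_right int) auto
    also have "(\<lambda>\<omega>. (fact k / (r0/2) ^ k) * ((Y \<omega> * (r0/2)) ^ k / fact k)) = (\<lambda>\<omega>. Y \<omega> ^ k)"
      using \<open>r0 > 0\<close> by (simp add: power_mult_distrib power_divide field_simps)
    finally show ?thesis .
  qed
  then show "integrable M (\<lambda>\<omega>. Y \<omega> ^ n)" .
  have sums_exp: "(\<lambda>k. z ^ k / fact k) sums exp z" for z :: real
    using exp_converges[of z] by (simp add: divide_inverse mult.commute)
  have "(\<lambda>k. integral\<^sup>L M (\<lambda>\<omega>. (Y \<omega> * t) ^ k / fact k)) sums
          integral\<^sup>L M (\<lambda>\<omega>. \<Sum>k. (Y \<omega> * t) ^ k / fact k)"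
  proof (rule sums_integral)
    show "AE \<omega> in M. summable (\<lambda>k. norm ((Y \<omega> * t) ^ k / fact k))"
    proof (intro AE_I2)
      fix \<omega>
      show "summable (\<lambda>k. norm ((Y \<omega> * t) ^ k / fact k))"
        using sums_summable[OF sums_exp[of "\<bar>Y \<omega> * t\<bar>"]] by (simp add: power_abs)
    qed
    show "summable (\<lambda>k. integral\<^sup>L M (\<lambda>\<omega>. norm ((Y \<omega> * t) ^ k / fact k)))"
    proof (rule summableI_nonneg_bounded)
      fix m
      have "(\<Sum>k<m. integral\<^sup>L M (\<lambda>\<omega>. norm ((Y \<omega> * t) ^ k / fact k)))
             = integral\<^sup>L M (\<lambda>\<omega>. \<Sum>k<m. norm ((Y \<omega> * t) ^ k / fact k))"
        by (intro Bochner_Integration.integral_sum[symmetric] integrable_norm int t)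
      also have "\<dots> \<le> integral\<^sup>L M (\<lambda>\<omega>. exp \<bar>Y \<omega> * t\<bar>)"
      proof (intro integral_mono Bochner_Integration.integrable_sum integrable_norm int t dom)
        fix \<omega>
        have "(\<Sum>k<m. \<bar>Y \<omega> * t\<bar> ^ k / fact k) \<le> (\<Sum>k. \<bar>Y \<omega> * t\<bar> ^ k / fact k)"
          by (intro sum_le_suminf sums_summable[OF sums_exp]) auto
        then show "(\<Sum>k<m. norm ((Y \<omega> * t) ^ k / fact k)) \<le> exp \<bar>Y \<omega> * t\<bar>"
          using sums_unique[OF sums_exp[of "\<bar>Y \<omega> * t\<bar>"]] by (simp add: power_abs)
      qed
      finally show "(\<Sum>k<m. integral\<^sup>L M (\<lambda>\<omega>. norm ((Y \<omega> * t) ^ k / fact k)))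
        \<le> integral\<^sup>L M (\<lambda>\<omega>. exp \<bar>Y \<omega> * t\<bar>)" .
    qed auto
  qed (intro int t)
  also have "(\<lambda>\<omega>. \<Sum>k. (Y \<omega> * t) ^ k / fact k) = (\<lambda>\<omega>. exp (Y \<omega> * t))"
    by (intro ext) (rule sums_unique[OF sums_exp, symmetric])
  finally have "(\<lambda>k. complex_of_real (integral\<^sup>L M (\<lambda>\<omega>. (Y \<omega> * t) ^ k / fact k))) sums
          of_real (integral\<^sup>L M (\<lambda>\<omega>. exp (Y \<omega> * t)))"
    by (rule sums_of_real)
  then show "(\<lambda>n. fps_nth (mgf_series M Y) n * of_real t ^ n) sums
           of_real (integral\<^sup>L M (\<lambda>\<omega>. exp (Y \<omega> * t)))"
    by (simp add: mgf_series_def power_mult_distrib mult_ac)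
qed

text \<open>The library's \<open>Stirling\<close> is defined by recursion; this is its generating function.\<close>
lemma Stirling_egf:
  "fps_const (1 / fact k) * (fps_exp 1 - 1 :: complex fps) ^ k
     = Abs_fps (\<lambda>n. of_nat (Stirling n k) / fact n)"
proof -
  define F where "F k = fps_const (1 / fact k) * (fps_exp 1 - 1 :: complex fps) ^ k" for k
  have deriv: "fps_deriv (F (Suc k)) = of_nat (Suc k) * F (Suc k) + F k" for k
  proof -
    have c: "of_nat (Suc k) * fps_const (1 / fact (Suc k)) = fps_const (1 / fact k :: complex)"
      unfolding fps_of_nat[symmetric] fps_const_mult
      by (simp del: of_nat_Suc)
    have "fps_deriv (F (Suc k)) =
        (of_nat (Suc k) * fps_const (1 / fact (Suc k))) * (fps_exp 1 - 1) ^ k * (fps_exp 1 :: complex fps)"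
      by (simp add: F_def fps_deriv_power' mult_ac del: of_nat_Suc power_Suc)
    also have "\<dots> = (of_nat (Suc k) * fps_const (1 / fact (Suc k))) * (fps_exp 1 - 1) ^ Suc k
                   + (of_nat (Suc k) * fps_const (1 / fact (Suc k))) * (fps_exp 1 - 1) ^ k"
      by (simp add: algebra_simps del: of_nat_Suc)
    finally show ?thesis by (simp only: F_def c flip: mult.assoc)
  qed
  have "fps_nth (F k) n = of_nat (Stirling n k) / fact n" for n
  proof (induction n k rule: Stirling.induct)
    case (2 k) then show ?case by (simp add: F_def)
  next
    case (4 n k)
    have "of_nat (Suc n) * fps_nth (F (Suc k)) (Suc n)
            = of_nat (Suc k) * fps_nth (F (Suc k)) n + fps_nth (F k) n"
      using arg_cong[OF deriv, of "\<lambda>f. fps_nth f n" k]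
      by (simp add: fps_of_nat[symmetric] del: of_nat_Suc)
    then show ?case
      using 4 by (simp add: field_simps del: of_nat_Suc) (simp add: algebra_simps)
  qed (auto simp: F_def)
  then show ?thesis by (simp add: fps_eq_iff F_def)
qed

end

theory Submission
  imports Defs
begin

text \<open>
  Write \<open>A\<close> for the series of \<open>E[e^(Y t)]\<close> and \<open>e = A - 1\<close>. Since the measure has total mass 1
  and \<open>Y\<close> has nonzero mean, \<open>e\<close> has no constant term and a nonzero linear term, so it has a compositional inverse.

  On the power \<open>A^x\<close> the difference operator in \<open>x\<close> acts as multiplication by \<open>A - 1 = e\<close>, and
  the operator \<open>f(x) \<mapsto> f(x + 1) + f(x)\<close> acts as multiplication by \<open>A + 1\<close>, which
  cancels the denominator in the generating function of the Euler polynomials. Evaluating at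
  \<open>x = 0\<close> gives
    \<open>\<Delta>^j \<E>\<^sub>k(1) + \<Delta>^j \<E>\<^sub>k(0) = 2 k! [t^k] e^j\<close>  (\<open>fwd_diff_prob_euler\<close>).
  The numbers \<open>S\<^sub>1(j, r) / j!\<close> are the coefficients of \<open>(inverse of e)^r / r!\<close>, so weighting by
  them and summing over \<open>j\<close> substitutes \<open>e\<close> into this series and leaves \<open>t^r / r!\<close>. This
  makes the functional \<open>f \<mapsto> \<Sum>\<^sub>j S\<^sub>1(j, r) / j! (\<Delta>^j f(1) + \<Delta>^j f(0)) / 2\<close> dual to the Euler
  polynomials (\<open>stirling1_dual_basis\<close>), and applying it to the expansion of \<open>q\<close> extracts \<open>a r\<close>.

  The other two formulas only rewrite \<open>\<Delta>^j q\<close>: by the binomial formula for iterated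
  differences (\<open>fwd_diff_funpow\<close>), and by its expansion in derivatives (\<open>fwd_diff_poly_Stirling\<close>),
  which combines Taylor's formula with the generating function of the \<open>S\<^sub>2(l, j)\<close>.
\<close>

section \<open>Iterated forward differences\<close>

lemma fwd_diff_funpow_Suc:
  "(fwd_diff ^^ Suc j) f x = (fwd_diff ^^ j) f (x + 1) - (fwd_diff ^^ j) f x"
  by (simp add: fwd_diff_def)

lemma fwd_diff_funpow:
  "(fwd_diff ^^ j) f x = (\<Sum>i=0..j. (-1) ^ (j - i) * of_nat (j choose i) * f (x + of_nat i))"
proof (induction j arbitrary: x)
  case (Suc j)
  define g where "g i = f (x + of_nat i)" for i
  have low: "(\<Sum>i\<le>Suc j. (-1) ^ (Suc j - i) * of_nat (j choose i) * g i)
               = - (\<Sum>i\<le>j. (-1) ^ (j - i) * of_nat (j choose i) * g i)"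
    by (simp add: Suc_diff_le binomial_eq_0 flip: sum_negf)
  \<comment> \<open>With its first term split off, this sum collects one of the two halves of Pascal's rule.\<close>
  have low_shift: "(\<Sum>i\<le>Suc j. (-1) ^ (Suc j - i) * of_nat (j choose i) * g i)
               = (-1) ^ Suc j * g 0 + (\<Sum>i\<le>j. (-1) ^ (j - i) * of_nat (j choose Suc i) * g (Suc i))"
    by (subst sum.atMost_Suc_shift) simp
  have "(\<Sum>i\<le>Suc j. (-1) ^ (Suc j - i) * of_nat (Suc j choose i) * g i)
          = (-1) ^ Suc j * g 0
            + (\<Sum>i\<le>j. (-1) ^ (j - i) * of_nat (Suc j choose Suc i) * g (Suc i))"
    by (subst sum.atMost_Suc_shift) simp
  also have "\<dots> = (\<Sum>i\<le>j. (-1) ^ (j - i) * of_nat (j choose i) * g (Suc i))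
                 + (\<Sum>i\<le>Suc j. (-1) ^ (Suc j - i) * of_nat (j choose i) * g i)"
    unfolding low_shift by (simp add: algebra_simps sum.distrib)
  finally show ?case
    unfolding low
    by (simp add: fwd_diff_funpow_Suc Suc.IH g_def atLeast0AtMost add_ac del: funpow.simps)
qed simp

lemma fwd_diff_funpow_sum:
  "(fwd_diff ^^ j) (\<lambda>x. \<Sum>k\<in>K. c k * f k x) x = (\<Sum>k\<in>K. c k * (fwd_diff ^^ j) (f k) x)"
  by (induction j arbitrary: x)
     (simp_all only: fwd_diff_funpow_Suc funpow_0 right_diff_distrib sum_subtractf)

section \<open>Differences of polynomials through derivatives\<close>

text \<open>
  The Taylor coefficients at \<open>c\<close> are the coefficients of the translate \<open>p(x + c)\<close>, which is read
  off by differentiating it at \<open>0\<close>: translation commutes with differentiation.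
\<close>
lemma poly_taylor:
  fixes p :: "'a::field_char_0 poly"
  shows "poly p (c + h) = (\<Sum>l=0..degree p. poly ((pderiv ^^ l) p) c / fact l * h ^ l)"
proof -
  define s where "s = pcompose p [:c, 1:]"
  have "(pderiv ^^ l) s = pcompose ((pderiv ^^ l) p) [:c, 1:]" for l
    by (induction l) (simp_all add: s_def pderiv_pcompose pderiv_pCons)
  then have "coeff ((pderiv ^^ l) s) 0 = poly ((pderiv ^^ l) p) c" for l
    by simp
  then have coeffs: "coeff s l = poly ((pderiv ^^ l) p) c / fact l" for l
    by (simp add: coeff_higher_pderiv pochhammer_fact[symmetric] field_simps)
  have "poly p (c + h) = poly s h"
    by (simp add: s_def poly_pcompose add.commute)
  also have "\<dots> = (\<Sum>l=0..degree s. coeff s l * h ^ l)"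
    by (simp add: poly_altdef atLeast0AtMost)
  also have "degree s = degree p"
    by (simp add: s_def degree_pcompose)
  finally show ?thesis
    by (simp only: coeffs)
qed

text \<open>Compare coefficients after expanding \<open>(e^t - 1)^j\<close> by the binomial theorem.\<close>
lemma alternating_binomial_power_sum:
  "(\<Sum>i=0..j. (-1) ^ (j - i) * of_nat (j choose i) * of_nat i ^ l)
     = (fact j * of_nat (Stirling l j) :: complex)"
proof -
  have "(fps_exp 1 - 1 :: complex fps) ^ j
          = (\<Sum>i=0..j. fps_const ((-1) ^ (j - i) * of_nat (j choose i)) * fps_exp (of_nat i))"
    using binomial_ring[of "fps_exp 1 :: complex fps" "-1" j]
    by (simp add: fps_exp_power_mult atLeast0AtMost mult_ac
          flip: fps_of_nat fps_const_mult fps_const_power fps_const_neg fps_const_1_eq_1)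
  then have "fps_nth ((fps_exp 1 - 1 :: complex fps) ^ j) l
          = (\<Sum>i=0..j. (-1) ^ (j - i) * of_nat (j choose i) * (of_nat i ^ l / fact l))"
    by (simp add: fps_sum_nth)
  moreover have "fps_nth ((fps_exp 1 - 1 :: complex fps) ^ j) l = fact j * of_nat (Stirling l j) / fact l"
    using arg_cong[OF Stirling_egf, of "\<lambda>F. fps_nth F l" j] by (simp add: field_simps)
  ultimately show ?thesis
    by (simp flip: sum_divide_distrib)
qed

lemma fwd_diff_poly_Stirling:
  "(fwd_diff ^^ j) (poly q) x
     = fact j * (\<Sum>l=j..degree q. of_nat (Stirling l j) / fact l * poly ((pderiv ^^ l) q) x)"
proof -
  have "(fwd_diff ^^ j) (poly q) x
      = (\<Sum>i=0..j. \<Sum>l=0..degree q.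
           (-1) ^ (j - i) * of_nat (j choose i) * of_nat i ^ l * (poly ((pderiv ^^ l) q) x / fact l))"
    unfolding fwd_diff_funpow poly_taylor by (simp add: sum_distrib_left mult_ac)
  also have "\<dots> = (\<Sum>l=0..degree q. fact j * of_nat (Stirling l j) * (poly ((pderiv ^^ l) q) x / fact l))"
    by (subst sum.swap) (simp only: alternating_binomial_power_sum flip: sum_distrib_right)
  also have "\<dots> = (\<Sum>l=j..degree q. fact j * of_nat (Stirling l j) * (poly ((pderiv ^^ l) q) x / fact l))"
    by (rule sum.mono_neutral_right) auto
  finally show ?thesis
    by (simp add: sum_distrib_left mult_ac)
qed

section \<open>Differences of the Euler polynomials\<close>

text \<open>This is \<open>(1 + e)^(x + 1) = (1 + e) (1 + e)^x\<close>.\<close>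
lemma fps_binomial_compose_plus_one:
  fixes e :: "complex fps"
  assumes "fps_nth e 0 = 0"
  shows "fps_binomial (x + 1) oo e = (1 + e) * (fps_binomial x oo e)"
  using assms
  by (simp add: fps_binomial_add_mult fps_binomial_1 fps_compose_mult_distrib
        fps_compose_add_distrib mult.commute)

lemma fwd_diff_fps_binomial_compose:
  fixes e :: "complex fps"
  assumes "fps_nth e 0 = 0"
  shows "(fwd_diff ^^ j) (\<lambda>x. c * fps_nth (H * (fps_binomial x oo e)) k) x
           = c * fps_nth (H * (e ^ j * (fps_binomial x oo e))) k"
  by (induction j arbitrary: x)
     (simp_all add: fwd_diff_funpow_Suc fps_binomial_compose_plus_one[OF assms] algebra_simps
        del: funpow.simps)

lemma mgf_series_nth_0:
  assumes "prob_space M"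
  shows "fps_nth (mgf_series M Y) 0 = 1"
  using prob_space.prob_space[OF assms] by (simp add: mgf_series_def)

lemma fwd_diff_prob_euler:
  assumes "prob_space M"
  shows "(fwd_diff ^^ j) (prob_euler M Y k) 1 + (fwd_diff ^^ j) (prob_euler M Y k) 0
           = 2 * fact k * fps_nth ((mgf_series M Y - 1) ^ j) k"
proof -
  define e where "e = mgf_series M Y - 1"
  define H where "H = 2 / (mgf_series M Y + 1)"
  have e0: "fps_nth e 0 = 0"
    by (simp add: e_def mgf_series_nth_0[OF assms])
  have "fps_nth (mgf_series M Y + 1) 0 \<noteq> 0"
    by (simp add: mgf_series_nth_0[OF assms])
  then have H: "H * (2 + e) = 2"
    by (simp add: H_def e_def fps_divide_unit mult.assoc inverse_mult_eq_1 add.commute)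
  have euler: "prob_euler M Y k = (\<lambda>x. fact k * fps_nth (H * (fps_binomial x oo e)) k)"
    by (simp add: prob_euler_def fun_eq_iff H_def e_def)
  have "(fwd_diff ^^ j) (prob_euler M Y k) 1 + (fwd_diff ^^ j) (prob_euler M Y k) 0
          = fact k * fps_nth (H * (e ^ j * (1 + e)) + H * e ^ j) k"
    unfolding euler fwd_diff_fps_binomial_compose[OF e0]
    using fps_binomial_compose_plus_one[OF e0, of 0] by (simp add: distrib_left)
  also have "H * (e ^ j * (1 + e)) + H * e ^ j = H * (2 + e) * e ^ j"
    by (simp add: algebra_simps)
  also have "\<dots> = fps_const 2 * e ^ j"
    by (simp only: H) (simp only: numeral_fps_const)
  finally show ?thesis
    by (simp add: e_def)
qed

section \<open>Extracting the coefficients\<close>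

text \<open>
  The sum is the coefficient of \<open>t^k\<close> in \<open>((inverse of e)^r / r!) \<circ> e = t^r / r!\<close>. Summing only
  over \<open>r \<le> j \<le> n\<close> loses nothing: the inverse of \<open>e\<close> has no constant term, so its \<open>r\<close>-th power starts
  at degree \<open>r\<close>, and likewise \<open>e^j\<close> has no terms of degree \<open>k \<le> n < j\<close>.
\<close>
lemma stirling1_dual_basis:
  assumes "prob_space M" and "integral\<^sup>L M Y \<noteq> 0" and "k \<le> n"
  shows "(\<Sum>j=r..n. prob_stirling1 M Y j r * (1 / fact j) *
            (fact k * fps_nth ((mgf_series M Y - 1) ^ j) k)) = (if k = r then 1 else 0)"
proof -
  define e where "e = mgf_series M Y - 1"
  define F where "F = fps_const (1 / fact r) * fps_inv e ^ r"
  have e0: "fps_nth e 0 = 0"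
    by (simp add: e_def mgf_series_nth_0[OF assms(1)])
  have e1: "fps_nth e 1 \<noteq> 0"
    using assms(2) by (simp add: e_def mgf_series_def)
  have stirling: "prob_stirling1 M Y j r * (1 / fact j) = fps_nth F j" for j
    by (simp add: prob_stirling1_def F_def e_def)
  have "(\<Sum>j=r..n. fps_nth F j * fps_nth (e ^ j) k) = (\<Sum>j=0..n. fps_nth F j * fps_nth (e ^ j) k)"
  proof (rule sum.mono_neutral_left)
    have "fps_nth (fps_inv e) 0 = 0"
      by (simp add: fps_inv_def)
    then have "\<forall>j<r. fps_nth (fps_inv e ^ r) j = 0"
      by (rule startsby_zero_power_prefix)
    then show "\<forall>j\<in>{0..n} - {r..n}. fps_nth F j * fps_nth (e ^ j) k = 0"
      by (auto simp: F_def)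
  qed auto
  also have "\<dots> = (\<Sum>j=0..k. fps_nth F j * fps_nth (e ^ j) k)"
    using \<open>k \<le> n\<close> startsby_zero_power_prefix[OF e0]
    by (intro sum.mono_neutral_right) auto
  also have "\<dots> = fps_nth (F oo e) k"
    by (simp add: fps_compose_nth)
  also have "F oo e = fps_const (1 / fact r) * fps_X ^ r"
    by (simp add: F_def fps_compose_mult_distrib[OF e0] fps_inv[OF e0 e1]
          flip: fps_compose_power[OF e0])
  finally have "fact k * (\<Sum>j=r..n. fps_nth F j * fps_nth (e ^ j) k) = (if k = r then 1 else 0)"
    by simp
  then show ?thesis
    unfolding stirling e_def[symmetric] by (simp add: sum_distrib_left mult_ac)
qed

lemma prob_euler_coefficient:
  assumes "prob_space M" and "integral\<^sup>L M Y \<noteq> 0" and "r \<le> n"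
    and f: "\<And>x. f x = (\<Sum>k=0..n. a k * prob_euler M Y k x)"
  shows "a r = 1 / 2 * (\<Sum>j=r..n. prob_stirling1 M Y j r * (1 / fact j) *
                  ((fwd_diff ^^ j) f 1 + (fwd_diff ^^ j) f 0))"
proof -
  have "f = (\<lambda>x. \<Sum>k=0..n. a k * prob_euler M Y k x)"
    using f by (simp add: fun_eq_iff)
  then have diff: "(fwd_diff ^^ j) f 1 + (fwd_diff ^^ j) f 0
      = (\<Sum>k=0..n. a k * (2 * fact k * fps_nth ((mgf_series M Y - 1) ^ j) k))" for j
    by (simp add: fwd_diff_funpow_sum sum.distrib distrib_left flip: fwd_diff_prob_euler[OF assms(1)])
  have "1 / 2 * (\<Sum>j=r..n. prob_stirling1 M Y j r * (1 / fact j) *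
                  ((fwd_diff ^^ j) f 1 + (fwd_diff ^^ j) f 0))
      = (\<Sum>j=r..n. \<Sum>k=0..n. a k * (prob_stirling1 M Y j r * (1 / fact j) *
            (fact k * fps_nth ((mgf_series M Y - 1) ^ j) k)))"
    unfolding diff by (simp add: sum_distrib_left mult_ac)
  also have "\<dots> = (\<Sum>k=0..n. a k * (\<Sum>j=r..n. prob_stirling1 M Y j r * (1 / fact j) *
            (fact k * fps_nth ((mgf_series M Y - 1) ^ j) k)))"
    by (subst sum.swap) (simp only: sum_distrib_left)
  also have "\<dots> = (\<Sum>k=0..n. a k * (if k = r then 1 else 0))"
    by (intro sum.cong refl arg_cong2[where f = "(*)"] stirling1_dual_basis assms) auto
  also have "\<dots> = a r"
    using \<open>r \<le> n\<close> by (simp add: mult_delta_right)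
  finally show ?thesis ..
qed

theorem theorem3p3:
  fixes M :: "'a measure" and Y :: "'a \<Rightarrow> real"
    and q :: "complex poly" and a :: "nat \<Rightarrow> complex" and n r :: nat
  assumes "prob_space M"
    and "Y \<in> borel_measurable M"
    and "mgf_exists_near_0 M Y"
    and "integral\<^sup>L M Y \<noteq> 0"
    and "degree q = n"
    and "\<forall>x. poly q x = (\<Sum>r=0..n. a r * prob_euler M Y r x)"
    and "r \<le> n"
  shows "a r = 1 / 2 * (\<Sum>j=r..n. prob_stirling1 M Y j r * (1 / fact j) *
                  ((fwd_diff ^^ j) (poly q) 1 + (fwd_diff ^^ j) (poly q) 0))
       \<and> a r = 1 / 2 * (\<Sum>j=r..n. \<Sum>i=0..j. (-1) ^ (j - i) * (1 / fact j) * of_nat (j choose i) *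
                  prob_stirling1 M Y j r * (poly q (of_nat (i + 1)) + poly q (of_nat i)))
       \<and> a r = 1 / 2 * (\<Sum>j=r..n. \<Sum>l=j..n. prob_stirling1 M Y j r * of_nat (Stirling l j) *
                  (1 / fact l) * (poly ((pderiv ^^ l) q) 1 + poly ((pderiv ^^ l) q) 0))"
proof -
  have differences: "a r = 1 / 2 * (\<Sum>j=r..n. prob_stirling1 M Y j r * (1 / fact j) *
                  ((fwd_diff ^^ j) (poly q) 1 + (fwd_diff ^^ j) (poly q) 0))"
    using assms by (intro prob_euler_coefficient) auto
  have binomial: "prob_stirling1 M Y j r * (1 / fact j) *
                  ((fwd_diff ^^ j) (poly q) 1 + (fwd_diff ^^ j) (poly q) 0)
      = (\<Sum>i=0..j. (-1) ^ (j - i) * (1 / fact j) * of_nat (j choose i) *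
                  prob_stirling1 M Y j r * (poly q (of_nat (i + 1)) + poly q (of_nat i)))" for j
    by (simp add: fwd_diff_funpow sum_distrib_left sum.distrib algebra_simps add_divide_distrib)
  have derivatives: "prob_stirling1 M Y j r * (1 / fact j) *
                  ((fwd_diff ^^ j) (poly q) 1 + (fwd_diff ^^ j) (poly q) 0)
      = (\<Sum>l=j..n. prob_stirling1 M Y j r * of_nat (Stirling l j) *
                  (1 / fact l) * (poly ((pderiv ^^ l) q) 1 + poly ((pderiv ^^ l) q) 0))" for j
    using assms(5)
    by (simp add: fwd_diff_poly_Stirling sum_distrib_left sum.distrib algebra_simps add_divide_distrib)
  show ?thesis
    using differences differences[unfolded binomial] differences[unfolded derivatives] by blast
qed

end
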